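(* Let $(S,\le)$ be a finite distributive lattice and let $Q\subseteq S$ be a nonempty decomposition-closed sublattice of $S$. Then there exists a modular function $F:S\to\mathbb{R}$ such that $Q=\arg\min_{s\in S}F(s)$, i.e. $Q$ is the minimizer set of $F$.
   Context: Let $(S,\le)$ be a finite (nonempty) lattice with meet $\wedge$ and join $\vee$. A function $F:S\to\mathbb{R}$ is modular if $F(s)+F(s')=F(s\wedge s')+F(s\vee s')$ for all $s,s'\in S$. A subset $Q\subseteq S$ is the minimizer set of $F:S\to\mathbb{R}$ if $Q=\arg\min_{s\in S}F(s)$, the set of all $s\in S$ at which $F$ attains its minimum over $S$. A sublattice is a nonempty subset closed under $\wedge$ and $\vee$ of $S$. For $a\le b$ in $S$, $[a,b]=\{x\in S: a\le x\le b\}$; a pair $s,s'\in[a,b]$ is a decomposition of $[a,b]$ if $s\wedge s'=a$ and $s\vee s'=b$. A sublattice $Q\subseteq S$ is decomposition closed if, whenever $a,b\in Q$ with $a\le b$ and $s,s'$ is a decomposition of $[a,b]$, both $s$ and $s'$ belong to $Q$. *)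

theory Defs
  imports Complex_Main
begin

definition modular :: "('a::lattice \<Rightarrow> real) \<Rightarrow> bool" where
  "modular F \<longleftrightarrow> (\<forall>s s'. F s + F s' = F (inf s s') + F (sup s s'))"

definition minimizer_set :: "('a \<Rightarrow> real) \<Rightarrow> 'a set" where
  "minimizer_set F = {s. is_arg_min F (\<lambda>t. t \<in> UNIV) s}"

definition sublattice :: "'a::lattice set \<Rightarrow> bool" where
  "sublattice Q \<longleftrightarrow> Q \<noteq> {} \<and> (\<forall>s\<in>Q. \<forall>s'\<in>Q. inf s s' \<in> Q \<and> sup s s' \<in> Q)"

definition decomposition :: "'a::lattice \<Rightarrow> 'a \<Rightarrow> 'a \<Rightarrow> 'a \<Rightarrow> bool" where
  "decomposition a b s s' \<longleftrightarrow> s \<in> {a..b} \<and> s' \<in> {a..b} \<and> inf s s' = a \<and> sup s s' = b"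

definition decomposition_closed :: "'a::lattice set \<Rightarrow> bool" where
  "decomposition_closed Q \<longleftrightarrow>
     (\<forall>a\<in>Q. \<forall>b\<in>Q. a \<le> b \<longrightarrow> (\<forall>s s'. decomposition a b s s' \<longrightarrow> s \<in> Q \<and> s' \<in> Q))"

end

theory Submission
  imports Defs
begin

text \<open>
  View an element \<open>x\<close> as the set of join-prime elements below it, the least element of \<open>S\<close>
  counting as join-prime. If \<open>p \<le> q\<close> are join-primes that no member of \<open>Q\<close> separates, then
  \<open>x \<mapsto> [p \<le> x] - [q \<le> x]\<close> is modular, nonnegative, and zero on \<open>Q\<close>; so is \<open>x \<mapsto> [p \<le> x]\<close> if
  \<open>p\<close> lies below no member of \<open>Q\<close>. Let \<open>F\<close> be the sum of all these functions. It remains to show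
  that a common zero \<open>x\<close> of them belongs to \<open>Q\<close>.

  Otherwise take \<open>b \<in> Q\<close> minimal with \<open>x \<sqinter> b \<notin> Q\<close>. The join \<open>c\<close> of all members of \<open>Q\<close> strictly
  below \<open>b\<close> satisfies \<open>x \<sqinter> c \<in> Q\<close>, hence \<open>c < b\<close>, and no member of \<open>Q\<close> separates two join-primes
  that are below \<open>b\<close> but not below \<open>c\<close>. As \<open>x\<close> is a common zero, the join-primes below \<open>b\<close> that are
  below \<open>c\<close> or not below \<open>x\<close> form a down-set; its join \<open>v\<close> together with \<open>x \<sqinter> b\<close> decomposes
  \<open>[x \<sqinter> c, b]\<close>, so \<open>x \<sqinter> b \<in> Q\<close> after all.
\<close>

definition join_prime :: "'a::lattice \<Rightarrow> bool" where
  "join_prime p \<longleftrightarrow> (\<forall>x y. p \<le> sup x y \<longrightarrow> p \<le> x \<or> p \<le> y)"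

lemma join_prime_le_sup_iff: "join_prime p \<Longrightarrow> p \<le> sup x y \<longleftrightarrow> p \<le> x \<or> p \<le> y"
  unfolding join_prime_def by (meson le_supI1 le_supI2)

lemma join_prime_le_Sup_fin_iff:
  assumes "join_prime p" "finite A" "A \<noteq> {}"
  shows "p \<le> Sup_fin A \<longleftrightarrow> (\<exists>a\<in>A. p \<le> a)"
  using assms(2,3)
  by (induction A rule: finite_ne_induct) (simp_all add: join_prime_le_sup_iff[OF assms(1)])

lemma Sup_fin_mem:
  assumes "finite A" "A \<noteq> {}" "A \<subseteq> T" "\<And>x y. x \<in> T \<Longrightarrow> y \<in> T \<Longrightarrow> sup x y \<in> T"
  shows "Sup_fin A \<in> T"
  using assms(1-3) by (induction A rule: finite_ne_induct) (simp_all add: assms(4))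

text \<open>Induction on the size of the down-set of \<open>x\<close>: if \<open>x\<close> is not
  join-prime, some \<open>u\<close>, \<open>v\<close> with \<open>x \<le> sup u v\<close> split it,
  by distributivity, into the join of the strictly smaller \<open>inf x u\<close> and
  \<open>inf x v\<close>.\<close>

lemma le_if_join_primes_le:
  fixes x y :: "'a::{finite, distrib_lattice}"
  assumes "\<And>p. join_prime p \<Longrightarrow> p \<le> x \<Longrightarrow> p \<le> y"
  shows "x \<le> y"
  using assms
proof (induction "card {..x}" arbitrary: x rule: less_induct)
  case less
  have smaller: "inf x u \<le> y" if "\<not> x \<le> u" for u
  proof (rule less.hyps)
    have "inf x u < x"
      using that by (metis inf.cobounded1 inf.cobounded2 less_le)
    then show "card {..inf x u} < card {..x}"
      by (intro psubset_card_mono) auto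
  qed (use less.prems in auto)
  show ?case
  proof (cases "join_prime x")
    case False
    then obtain u v where uv: "x \<le> sup u v" "\<not> x \<le> u" "\<not> x \<le> v"
      unfolding join_prime_def by blast
    then have "x = sup (inf x u) (inf x v)"
      by (metis inf.absorb1 inf_sup_distrib1)
    then show ?thesis
      using smaller uv by (metis le_supI)
  qed (use less.prems in blast)
qed

lemma eq_if_join_primes_le_iff:
  fixes x y :: "'a::{finite, distrib_lattice}"
  assumes "\<And>p. join_prime p \<Longrightarrow> p \<le> x \<longleftrightarrow> p \<le> y"
  shows "x = y"
  by (rule antisym; rule le_if_join_primes_le) (use assms in auto)

text \<open>Below, the bottom element keeps \<open>V\<close> nonempty, so that
  \<open>Sup_fin V\<close> is a genuine join, and serves as \<open>p\<close> in
  \<open>compat\<close> when \<open>b\<close> is the least member of \<open>Q\<close>.\<close>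

lemma join_prime_Inf_fin_UNIV: "join_prime (Inf_fin UNIV :: 'a::{finite, lattice})"
  by (simp add: join_prime_def Inf_fin.coboundedI)

lemma modular_of_bool_join_prime:
  assumes "join_prime p"
  shows "modular (\<lambda>x. of_bool (p \<le> x))"
  by (auto simp: modular_def join_prime_le_sup_iff[OF assms])

lemma modular_diff: "modular F \<Longrightarrow> modular G \<Longrightarrow> modular (\<lambda>x. F x - G x)"
  unfolding modular_def by (smt (verit))

lemma modular_add: "modular F \<Longrightarrow> modular G \<Longrightarrow> modular (\<lambda>x. F x + G x)"
  unfolding modular_def by (smt (verit))

lemma modular_sum: "(\<And>i. i \<in> I \<Longrightarrow> modular (F i)) \<Longrightarrow> modular (\<lambda>x. \<Sum>i\<in>I. F i x)"
  unfolding modular_def sum.distrib[symmetric] by (intro allI sum.cong) blast+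

text \<open>In \<open>theorem1\<close>, \<open>cover\<close> and \<open>compat\<close> express that
  the summands of \<open>F\<close> indexed by \<open>N\<close> and by \<open>E\<close> vanish at
  \<open>x\<close>.\<close>

lemma mem_if_compatible:
  fixes Q :: "'a::{finite, distrib_lattice} set"
  assumes Q: "sublattice Q" and dec: "decomposition_closed Q"
    and cover: "\<And>p. join_prime p \<Longrightarrow> p \<le> x \<Longrightarrow> \<exists>s\<in>Q. p \<le> s"
    and compat: "\<And>p q. join_prime p \<Longrightarrow> join_prime q \<Longrightarrow> p \<le> q \<Longrightarrow>
      (\<forall>s\<in>Q. p \<le> s \<longrightarrow> q \<le> s) \<Longrightarrow> p \<le> x \<Longrightarrow> q \<le> x"
  shows "x \<in> Q"
proof (rule ccontr)
  assume "x \<notin> Q"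
  have infQ: "inf s t \<in> Q" and supQ: "sup s t \<in> Q" if "s \<in> Q" "t \<in> Q" for s t
    using Q that by (auto simp: sublattice_def)
  have "Q \<noteq> {}"
    using Q by (simp add: sublattice_def)
  define T where "T = {s \<in> Q. inf x s \<in> Q}"
  have supT: "sup s t \<in> T" if "s \<in> T" "t \<in> T" for s t
    using that by (simp add: T_def supQ inf_sup_distrib1)
  \<comment> \<open>If the top \<open>Sup_fin Q\<close> of \<open>Q\<close> were in
    \<open>T\<close>, then \<open>x\<close>, being its own meet with that top, would be in
    \<open>Q\<close>. Hence \<open>Q - T\<close> is nonempty.\<close>
  have "x \<le> Sup_fin Q"
  proof (rule le_if_join_primes_le)
    fix p assume "join_prime p" "p \<le> x"
    then show "p \<le> Sup_fin Q"
      using cover \<open>Q \<noteq> {}\<close> by (simp add: join_prime_le_Sup_fin_iff)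
  qed
  moreover have "Sup_fin Q \<in> Q"
    using \<open>Q \<noteq> {}\<close> supQ by (intro Sup_fin_mem) auto
  ultimately have "Q - T \<noteq> {}"
    using \<open>x \<notin> Q\<close> by (metis (lifting) DiffI T_def empty_iff inf.absorb1 mem_Collect_eq)
  then obtain b where b: "b \<in> Q - T" "\<And>s. s \<in> Q - T \<Longrightarrow> s \<le> b \<Longrightarrow> b = s"
    using finite_has_minimal[of "Q - T"] by (metis finite)
  define A where "A = {s \<in> Q. s < b}"
  have "A \<subseteq> T"
    using b unfolding A_def by (metis (lifting) DiffI less_le mem_Collect_eq subsetI)
  \<comment> \<open>Otherwise \<open>b\<close> is least in \<open>Q\<close>, every join-prime below
    \<open>b\<close> lies below all of \<open>Q\<close>, and \<open>compat\<close> forces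
    \<open>b \<le> x\<close>, so \<open>inf x b = b\<close> is in \<open>Q\<close>.\<close>
  have "A \<noteq> {}"
  proof
    assume "A = {}"
    then have least: "b \<le> s" if "s \<in> Q" for s
      using infQ[OF that, of b] b(1) \<open>A = {}\<close> unfolding A_def
      by (metis (lifting) DiffD1 empty_iff inf.cobounded1 inf.cobounded2 less_le mem_Collect_eq)
    have "b \<le> x"
    proof (rule le_if_join_primes_le)
      fix p assume "join_prime p" "p \<le> b"
      then show "p \<le> x"
        using compat[OF join_prime_Inf_fin_UNIV, of p] least
        by (meson Inf_fin.coboundedI UNIV_I finite order_trans)
    qed
    with b(1) show False
      by (simp add: T_def inf.absorb2)
  qed
  define c where "c = Sup_fin A"
  have "c \<in> T"
    unfolding c_def using \<open>A \<noteq> {}\<close> \<open>A \<subseteq> T\<close> supT by (intro Sup_fin_mem) auto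
  have "c \<le> b"
    unfolding c_def using \<open>A \<noteq> {}\<close> by (intro Sup_fin.boundedI) (auto simp: A_def)
  have nonsep: "q \<le> s" if "s \<in> Q" "p \<le> s" "p \<le> b" "\<not> p \<le> c" "q \<le> b" for p q s
  proof -
    \<comment> \<open>The member \<open>inf s b\<close> of \<open>Q\<close> lies above
      \<open>p\<close>, hence not below \<open>c\<close>; so it is not strictly below
      \<open>b\<close> and must equal \<open>b\<close>.\<close>
    have "inf s b \<notin> A"
      using that Sup_fin.coboundedI[of A "inf s b"] unfolding c_def
      by (metis finite le_inf_iff order_trans)
    then have "b \<le> s"
      using infQ[OF that(1), of b] b(1) unfolding A_def
      by (metis (lifting) DiffD1 inf.cobounded1 inf.cobounded2 less_le mem_Collect_eq)
    with that show ?thesis by order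
  qed
  define V where "V = {r. join_prime r \<and> r \<le> b \<and> (r \<le> c \<or> \<not> r \<le> x)}"
  have "Inf_fin UNIV \<in> V"
    by (simp add: V_def join_prime_Inf_fin_UNIV Inf_fin.coboundedI)
  then have "V \<noteq> {}"
    by blast
  define v where "v = Sup_fin V"
  have le_v: "r \<le> v \<longleftrightarrow> r \<le> b \<and> (r \<le> c \<or> \<not> r \<le> x)" if r: "join_prime r" for r
  proof
    assume "r \<le> v"
    then obtain q where q: "q \<in> V" "r \<le> q"
      using r \<open>V \<noteq> {}\<close> unfolding v_def by (meson finite join_prime_le_Sup_fin_iff)
    \<comment> \<open>This makes \<open>V\<close> a down-set among the join-primes: if
      \<open>r \<le> x\<close>, then \<open>q\<close>, also not below \<open>c\<close>, is carried
      below \<open>x\<close> by \<open>nonsep\<close> and \<open>compat\<close>, against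
      \<open>q \<in> V\<close>.\<close>
    have "\<not> r \<le> x" if "\<not> r \<le> c"
    proof
      assume "r \<le> x"
      have "\<not> q \<le> c" using that q by order
      moreover have "q \<le> x"
      proof (rule compat[OF r])
        show "\<forall>s\<in>Q. r \<le> s \<longrightarrow> q \<le> s"
          using q that nonsep[where p = r and q = q] unfolding V_def
          by (metis (lifting) mem_Collect_eq order_trans)
      qed (use q \<open>r \<le> x\<close> in \<open>simp_all add: V_def\<close>)
      ultimately show False
        using q by (simp add: V_def)
    qed
    then show "r \<le> b \<and> (r \<le> c \<or> \<not> r \<le> x)"
      using q unfolding V_def by (metis (lifting) mem_Collect_eq order_trans)
  qed (simp add: v_def V_def r Sup_fin.coboundedI)
  have "inf (inf x b) v = inf x c"
    by (rule eq_if_join_primes_le_iff) (use \<open>c \<le> b\<close> order_trans in \<open>auto simp: le_v\<close>)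
  moreover have "sup (inf x b) v = b"
    by (rule eq_if_join_primes_le_iff) (auto simp: join_prime_le_sup_iff le_v)
  ultimately have "decomposition (inf x c) b (inf x b) v"
    unfolding decomposition_def by (metis atLeastAtMost_iff inf.cobounded1 inf.cobounded2
        sup.cobounded1 sup.cobounded2)
  then have "inf x b \<in> Q"
    using dec b(1) \<open>c \<in> T\<close> \<open>c \<le> b\<close> unfolding decomposition_closed_def T_def
    by (metis (lifting) DiffD1 inf.coboundedI2 mem_Collect_eq)
  with b(1) show False
    by (simp add: T_def)
qed

theorem theorem1:
  fixes Q :: "'a::{finite, distrib_lattice} set"
  assumes "sublattice Q"
    and "decomposition_closed Q"
  shows "\<exists>F :: 'a \<Rightarrow> real. modular F \<and> Q = minimizer_set F"
proof -
  define N where "N = {p::'a. join_prime p \<and> (\<forall>s\<in>Q. \<not> p \<le> s)}"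
  define E where "E = {(p::'a, q). join_prime p \<and> join_prime q \<and> p \<le> q \<and> (\<forall>s\<in>Q. p \<le> s \<longrightarrow> q \<le> s)}"
  define g :: "'a \<times> 'a \<Rightarrow> 'a \<Rightarrow> real"
    where "g = (\<lambda>(p, q) x. of_bool (p \<le> x) - of_bool (q \<le> x))"
  define F :: "'a \<Rightarrow> real" where "F = (\<lambda>x. (\<Sum>p\<in>N. of_bool (p \<le> x)) + (\<Sum>e\<in>E. g e x))"
  have "modular F"
    unfolding F_def
    by (intro modular_add modular_sum)
      (auto simp: N_def E_def g_def intro!: modular_diff modular_of_bool_join_prime)
  have g_nonneg: "0 \<le> g e x" if "e \<in> E" for e x
    using that by (auto simp: E_def g_def)
  have N_nonneg: "0 \<le> (\<Sum>p\<in>N. of_bool (p \<le> x) :: real)" for x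
    by (simp add: sum_nonneg)
  have E_nonneg: "0 \<le> (\<Sum>e\<in>E. g e x)" for x
    by (simp add: sum_nonneg g_nonneg)
  have F_nonneg: "0 \<le> F x" for x
    using N_nonneg E_nonneg by (simp add: F_def)
  have zero: "F x = 0" if "x \<in> Q" for x
  proof -
    have "N \<inter> {p. p \<le> x} = {}"
      using \<open>x \<in> Q\<close> by (auto simp: N_def)
    moreover have "g e x = 0" if "e \<in> E" for e
      using that \<open>x \<in> Q\<close> by (auto simp: E_def g_def)
    ultimately show ?thesis
      by (simp add: F_def)
  qed
  have mem: "x \<in> Q" if "F x = 0" for x
  proof (rule mem_if_compatible[OF assms])
    \<comment> \<open>Both sums are nonnegative and add up to 0, so each vanishes, and then so does
      each summand.\<close>
    have sums: "(\<Sum>p\<in>N. of_bool (p \<le> x) :: real) = 0" "(\<Sum>e\<in>E. g e x) = 0"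
      using that N_nonneg[of x] E_nonneg[of x] unfolding F_def by linarith+
    have N0: "\<not> p \<le> x" if "p \<in> N" for p
      using that sums(1) by (auto simp: sum_nonneg_eq_0_iff)
    have E0: "g e x = 0" if "e \<in> E" for e
      using that sums(2) by (simp add: sum_nonneg_eq_0_iff g_nonneg)
    show "\<exists>s\<in>Q. p \<le> s" if "join_prime p" "p \<le> x" for p
      using that N0[of p] by (auto simp: N_def)
    show "q \<le> x" if "join_prime p" "join_prime q" "p \<le> q" "\<forall>s\<in>Q. p \<le> s \<longrightarrow> q \<le> s" "p \<le> x" for p q
      using that E0[of "(p, q)"] by (auto simp: E_def g_def)
  qed
  obtain s where "s \<in> Q"
    using assms(1) by (auto simp: sublattice_def)
  then have "minimizer_set F = {x. F x = 0}"
    using F_nonneg zero unfolding minimizer_set_def is_arg_min_def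
    by (auto simp: not_less) (metis antisym F_nonneg linorder_not_less)
  with \<open>modular F\<close> zero mem show ?thesis
    by blast
qed

end
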